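(* Define on $D$ $$\underline V(s,x,w)=x+d_{\mathscr D}(s,x,w)-N_2(T-s),\qquad N_2=\tfrac{\sqrt2}{2}+1+(c+\Lambda)\tfrac{2T}{2+\sqrt2},$$ where $d_{\mathscr D}(s,x,w)=\min\{T-s,\ w,\ \tfrac{\sqrt2}{2}(s-w),\ x\}$. Then $\underline V$ is a viscosity subsolution on $\mathscr D^*$ of the HJB equation $$\max\{1-V_x,\ \mathscr L[V]\}(s,x,w)=0\ \text{ for }(s,x,w)\in\mathscr D,\qquad V(T,x,w)=x,$$ and for all $(s,x,w)\in D$, $x+M_2\le\underline V(s,x,w)\le x+M_1$.
   Context: $T>0$, $p>0$, $c>0$ are constants; $G$ is a continuous distribution function on $[0,\infty)$ (of claim sizes in $[0,\infty)$); $\lambda:[0,\infty)\to[0,\infty)$ is continuous and bounded, $\lambda>0$ on $[0,T]$, and $\Lambda>0$ is a constant with $\lambda(w)\le\Lambda$ for all $w\in[0,T]$. Constants: $M_1=(\frac{\sqrt2}{2}+1+2p)T+\frac{T}{2+\sqrt2}$ and $M_2=-\big[\frac{\sqrt2}{2}+1+(c+\Lambda)\frac{2T}{2+\sqrt2}\big]T$. Domains. $D=\{(s,x,w):0\le s\le T,\ x\ge0,\ 0\le w\le s\}$, $\mathscr D=\operatorname{int}D=\{0<s<T,\ x>0,\ 0<w<s\}$, $\mathscr D^*=\{(s,x,w)\in D:\ 0\le s<T\}$. Operator. For continuously differentiable $\varphi$, $$\mathscr L[\varphi](s,x,w)=[-c\varphi+\varphi_s+p\varphi_x+\varphi_w](s,x,w)+\lambda(w)\Big[\int_0^x\varphi(s,x-u,0)\,dG(u)-\varphi(s,x,w)\Big].$$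 Viscosity subsolution. Let $O\subseteq\mathscr D^*$ with $\partial_TO:=\{(T,y,r)\in\partial O\}\ne\emptyset$, and let $\mathbb C^{1,1,1}(\bar O)$ be the continuously differentiable functions on $\bar O$. A function $v:D\to\mathbb R$, upper semicontinuous on $O$, is a viscosity subsolution of the equation on $O$ if $v(T,y,r)\le y$ for all $(T,y,r)\in\partial_TO$ and, for every $(s,x,w)\in O$ and $\varphi\in\mathbb C^{1,1,1}(\bar O)$ with $0=[v-\varphi](s,x,w)=\max_{O}[v-\varphi]$, one has $\max\{1-\varphi_x,\mathscr L[\varphi]\}(s,x,w)\ge0$. *)

theory Defs
  imports "HOL-Analysis.Analysis"
begin

text \<open>Points are triples \<open>(s, x, w)\<close>: time, surplus, time elapsed since the last claim.\<close>

definition dom_D :: "real \<Rightarrow> (real \<times> real \<times> real) set" where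
  "dom_D T = {(s, x, w). 0 \<le> s \<and> s \<le> T \<and> 0 \<le> x \<and> 0 \<le> w \<and> w \<le> s}"

definition dom_D_star :: "real \<Rightarrow> (real \<times> real \<times> real) set" where
  "dom_D_star T = {(s, x, w). (s, x, w) \<in> dom_D T \<and> 0 \<le> s \<and> s < T}"

text \<open>The Frechet derivative is taken within \<open>S\<close>, so that it also makes sense at boundary points;
  it is unique at every point of \<open>S\<close> when \<open>S\<close> is convex with nonempty interior, as the closure
  of \<open>dom_D_star T\<close> is for \<open>T > 0\<close>. Coordinatewise one-sided derivatives would not do:
  at \<open>s = w = 0\<close> the domain contains no segment in the \<open>w\<close>-direction.\<close>

definition C1_on :: "'a::real_normed_vector set \<Rightarrow> ('a \<Rightarrow> real) \<Rightarrow> bool" where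
  "C1_on S \<phi> \<longleftrightarrow> \<phi> differentiable_on S \<and>
     (\<forall>h. continuous_on S (\<lambda>z. frechet_derivative \<phi> (at z within S) h))"

definition deriv_s :: "(real \<times> real \<times> real) set \<Rightarrow> (real \<times> real \<times> real \<Rightarrow> real)
    \<Rightarrow> real \<times> real \<times> real \<Rightarrow> real" where
  "deriv_s S \<phi> z = frechet_derivative \<phi> (at z within S) (1, 0, 0)"

definition deriv_x :: "(real \<times> real \<times> real) set \<Rightarrow> (real \<times> real \<times> real \<Rightarrow> real)
    \<Rightarrow> real \<times> real \<times> real \<Rightarrow> real" where
  "deriv_x S \<phi> z = frechet_derivative \<phi> (at z within S) (0, 1, 0)"

definition deriv_w :: "(real \<times> real \<times> real) set \<Rightarrow> (real \<times> real \<times> real \<Rightarrow> real)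
    \<Rightarrow> real \<times> real \<times> real \<Rightarrow> real" where
  "deriv_w S \<phi> z = frechet_derivative \<phi> (at z within S) (0, 0, 1)"

text \<open>The integral against \<open>dG\<close> is the Lebesgue-Stieltjes integral with respect to
  \<open>interval_measure G\<close>, which is meaningful for nondecreasing right-continuous \<open>G\<close>;
  \<open>S\<close> is the set within which the derivatives are taken.\<close>

definition gen_L :: "real \<Rightarrow> real \<Rightarrow> (real \<Rightarrow> real) \<Rightarrow> (real \<Rightarrow> real) \<Rightarrow> (real \<times> real \<times> real) set
    \<Rightarrow> (real \<times> real \<times> real \<Rightarrow> real) \<Rightarrow> real \<times> real \<times> real \<Rightarrow> real" where
  "gen_L p c G lam S \<phi> = (\<lambda>(s, x, w).
     - c * \<phi> (s, x, w) + deriv_s S \<phi> (s, x, w) + p * deriv_x S \<phi> (s, x, w) + deriv_w S \<phi> (s, x, w)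
     + lam w * ((LINT u:{0..x}|interval_measure G. \<phi> (s, x - u, 0)) - \<phi> (s, x, w)))"

definition upper_semicontinuous_on :: "'a::topological_space set \<Rightarrow> ('a \<Rightarrow> real) \<Rightarrow> bool" where
  "upper_semicontinuous_on S f \<longleftrightarrow>
     (\<forall>z\<in>S. \<forall>a>f z. eventually (\<lambda>y. f y < a) (at z within S))"

definition terminal_boundary :: "real \<Rightarrow> (real \<times> real \<times> real) set \<Rightarrow> (real \<times> real \<times> real) set" where
  "terminal_boundary T O' = {(t, y, r). t = T \<and> (t, y, r) \<in> frontier O'}"

text \<open>The standing requirements on the set \<open>O'\<close> are part of the definition. Only the values of
  \<open>v\<close> on \<open>dom_D T\<close> are used. For \<open>O' = dom_D_star T\<close> the integral in \<open>gen_L\<close> only uses values of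
  the test function on \<open>O'\<close>.\<close>

definition viscosity_subsolution :: "real \<Rightarrow> real \<Rightarrow> real \<Rightarrow> (real \<Rightarrow> real) \<Rightarrow> (real \<Rightarrow> real)
    \<Rightarrow> (real \<times> real \<times> real) set \<Rightarrow> (real \<times> real \<times> real \<Rightarrow> real) \<Rightarrow> bool" where
  "viscosity_subsolution T p c G lam O' v \<longleftrightarrow>
     O' \<subseteq> dom_D_star T \<and> terminal_boundary T O' \<noteq> {} \<and>
     upper_semicontinuous_on O' v \<and>
     (\<forall>y r. (T, y, r) \<in> terminal_boundary T O' \<longrightarrow> v (T, y, r) \<le> y) \<and>
     (\<forall>z\<in>O'. \<forall>\<phi>. C1_on (closure O') \<phi> \<and> v z - \<phi> z = 0 \<and> (\<forall>y\<in>O'. v y - \<phi> y \<le> v z - \<phi> z)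
        \<longrightarrow> max (1 - deriv_x (closure O') \<phi> z) (gen_L p c G lam (closure O') \<phi> z) \<ge> 0)"

definition dist_D :: "real \<Rightarrow> real \<times> real \<times> real \<Rightarrow> real" where
  "dist_D T = (\<lambda>(s, x, w). Min {T - s, w, sqrt 2 / 2 * (s - w), x})"

definition N2 :: "real \<Rightarrow> real \<Rightarrow> real \<Rightarrow> real" where
  "N2 T c \<Lambda> = sqrt 2 / 2 + 1 + (c + \<Lambda>) * (2 * T / (2 + sqrt 2))"

definition V_lower :: "real \<Rightarrow> real \<Rightarrow> real \<Rightarrow> real \<times> real \<times> real \<Rightarrow> real" where
  "V_lower T c \<Lambda> = (\<lambda>(s, x, w). x + dist_D T (s, x, w) - N2 T c \<Lambda> * (T - s))"

definition M1 :: "real \<Rightarrow> real \<Rightarrow> real" where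
  "M1 T p = (sqrt 2 / 2 + 1 + 2 * p) * T + T / (2 + sqrt 2)"

definition M2 :: "real \<Rightarrow> real \<Rightarrow> real \<Rightarrow> real" where
  "M2 T c \<Lambda> = - ((sqrt 2 / 2 + 1 + (c + \<Lambda>) * (2 * T / (2 + sqrt 2))) * T)"

end

theory Submission
  imports Defs
begin

text \<open>
  The function \<open>V = V_lower\<close> is the affine function \<open>x - N2 (T - s)\<close> plus the minimum \<open>d\<close> of four
  affine functions, and a test function \<open>\<phi>\<close> touches it from above. Hence in every direction
  \<open>h\<close> pointing into the domain, \<open>\<phi>'(h)\<close> dominates the one-sided slope of \<open>V\<close>. Two directions
  decide everything.

  In the direction of decreasing \<open>x\<close>: where the constraint \<open>x\<close> does not realise \<open>d\<close>, \<open>V\<close> has slope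
  \<open>-1\<close>, so \<open>\<phi>\<^sub>x \<le> 1\<close> and the first entry of the maximum is nonnegative.

  Otherwise \<open>d = x\<close> (this covers \<open>x = 0\<close>), and \<open>x \<le> T / (2 + sqrt 2)\<close> because \<open>T - s\<close>, \<open>w\<close> and
  \<open>s - w\<close> add up to \<open>T\<close>. Assume \<open>\<phi>\<^sub>x > 1\<close>. The direction \<open>(1, 0, 1)\<close> of the deterministic drift
  points into the domain everywhere before time \<open>T\<close>, even on the faces \<open>w = 0\<close> and \<open>w = s\<close>, and
  along it \<open>d\<close> loses at most one unit per unit of time; thus \<open>\<phi>\<^sub>s + \<phi>\<^sub>w \<ge> N2 - 1\<close>. After a claim
  \<open>w = 0\<close>, hence \<open>d = 0\<close> and \<open>\<phi> \<ge> V \<ge> - N2 (T - s)\<close>, so that the integral term is at least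
  \<open>- N2 (T - s)\<close>, the total mass of \<open>dG\<close> being \<open>1\<close>. As \<open>\<phi> = V = 2 x - N2 (T - s)\<close> at the contact
  point, the zero-order terms cost at most \<open>2 (c + \<Lambda>) x \<le> N2 - 1 - sqrt 2 / 2\<close>, which the drift pays
  for.
\<close>

section \<open>One-sided slopes\<close>

text \<open>A derivative within \<open>S\<close> bounds difference quotients along every segment that starts at \<open>z\<close> and
  runs inside \<open>S\<close>. This treats boundary points of the domain like interior ones; no partial
  derivative has to be computed there.\<close>

lemma has_derivative_within_ge_slope:
  fixes \<phi> :: "'a::real_normed_vector \<Rightarrow> real"
  assumes der: "(\<phi> has_derivative F) (at z within S)" and "\<delta> > 0"
    and in_S: "\<And>t. 0 < t \<Longrightarrow> t < \<delta> \<Longrightarrow> z + t *\<^sub>R h \<in> S"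
    and slope: "\<And>t. 0 < t \<Longrightarrow> t < \<delta> \<Longrightarrow> \<phi> z + a * t \<le> \<phi> (z + t *\<^sub>R h)"
  shows "a \<le> F h"
proof -
  let ?I = "{0<..<\<delta>}"
  have line: "((\<lambda>t. z + t *\<^sub>R h) has_derivative (\<lambda>t. t *\<^sub>R h)) (at 0 within ?I)"
    by (auto intro!: derivative_eq_intros)
  have der': "(\<phi> has_derivative F) (at (z + 0 *\<^sub>R h) within (\<lambda>t. z + t *\<^sub>R h) ` ?I)"
    using in_S by (auto intro: has_derivative_subset[OF der])
  have "((\<lambda>t. \<phi> (z + t *\<^sub>R h)) has_derivative (\<lambda>t. F (t *\<^sub>R h))) (at 0 within ?I)"
    using has_derivative_in_compose[OF line der'] .
  moreover have "(\<lambda>t. F (t *\<^sub>R h)) = (*) (F h)"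
    using linear_scale[OF has_derivative_linear[OF der]] by (auto simp: mult.commute)
  ultimately have "((\<lambda>t. \<phi> (z + t *\<^sub>R h)) has_field_derivative F h) (at 0 within ?I)"
    by (simp add: has_field_derivative_def)
  then have "((\<lambda>t. (\<phi> (z + t *\<^sub>R h) - \<phi> z) / t) \<longlongrightarrow> F h) (at 0 within ?I)"
    by (simp add: has_field_derivative_iff)
  moreover have "\<forall>\<^sub>F t in at 0 within ?I. a \<le> (\<phi> (z + t *\<^sub>R h) - \<phi> z) / t"
    unfolding eventually_at_filter using slope by (intro always_eventually) (force simp: field_simps)
  moreover have "at 0 within ?I \<noteq> bot"
    using \<open>\<delta> > 0\<close> by (simp add: at_within_eq_bot_iff)
  ultimately show ?thesis
    by (rule tendsto_lowerbound)
qed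

section \<open>Geometry of the domain and the growth bounds\<close>

lemma dist_D_eq: "dist_D T (s, x, w) = min (T - s) (min w (min (sqrt 2 / 2 * (s - w)) x))"
  by (simp add: dist_D_def)

lemma dist_D_nonneg: "(s, x, w) \<in> dom_D T \<Longrightarrow> 0 \<le> dist_D T (s, x, w)"
  by (auto simp: dist_D_eq dom_D_def)

text \<open>The distances to the faces \<open>s = T\<close>, \<open>w = 0\<close> and \<open>w = s\<close>, weighted by \<open>1\<close>, \<open>1\<close> and \<open>sqrt 2\<close>, add
  up to \<open>T\<close>, so the smallest one cannot exceed the weighted mean; this is the inradius of the
  triangle \<open>0 \<le> w \<le> s \<le> T\<close>.\<close>

lemma dist_D_le_inradius: "dist_D T (s, x, w) \<le> T / (2 + sqrt 2)"
proof -
  let ?d = "dist_D T (s, x, w)"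
  have "?d \<le> T - s" "?d \<le> w" "?d \<le> sqrt 2 / 2 * (s - w)"
    unfolding dist_D_eq by (simp_all only: min_le_iff_disj order_refl simp_thms)
  moreover from this(3) have "sqrt 2 * ?d \<le> sqrt 2 * (sqrt 2 / 2 * (s - w))"
    by (intro mult_left_mono) auto
  then have "sqrt 2 * ?d \<le> s - w"
    by (simp flip: mult.assoc)
  ultimately have "?d * (2 + sqrt 2) \<le> T"
    by (simp add: algebra_simps)
  moreover have "0 < 2 + sqrt 2"
    by (simp add: add_pos_nonneg)
  ultimately show ?thesis
    by (simp add: pos_le_divide_eq)
qed

lemma N2_pos:
  assumes "T > 0" "c > 0" "\<Lambda> > 0"
  shows "0 < N2 T c \<Lambda>"
proof -
  have "0 \<le> (c + \<Lambda>) * (2 * T / (2 + sqrt 2))"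
    using assms by (intro mult_nonneg_nonneg divide_nonneg_nonneg) auto
  then show ?thesis
    by (simp add: N2_def add_pos_nonneg)
qed

lemma V_lower_bounds:
  assumes "T > 0" "p > 0" "c > 0" "\<Lambda> > 0" and D: "(s, x, w) \<in> dom_D T"
  shows "x + M2 T c \<Lambda> \<le> V_lower T c \<Lambda> (s, x, w)"
    and "V_lower T c \<Lambda> (s, x, w) \<le> x + M1 T p"
proof -
  have "0 \<le> s" "s \<le> T"
    using D by (auto simp: dom_D_def)
  then have "N2 T c \<Lambda> * (T - s) \<le> N2 T c \<Lambda> * T" "0 \<le> N2 T c \<Lambda> * (T - s)"
    using N2_pos[OF assms(1,3,4)] by (auto intro!: mult_left_mono)
  moreover have "M2 T c \<Lambda> = - (N2 T c \<Lambda> * T)"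
    by (simp add: M2_def N2_def)
  moreover have "0 \<le> (sqrt 2 / 2 + 1 + 2 * p) * T"
    using assms by simp
  then have "T / (2 + sqrt 2) \<le> M1 T p"
    by (simp add: M1_def)
  ultimately show "x + M2 T c \<Lambda> \<le> V_lower T c \<Lambda> (s, x, w)" "V_lower T c \<Lambda> (s, x, w) \<le> x + M1 T p"
    using dist_D_nonneg[OF D] dist_D_le_inradius[of T s x w] by (auto simp: V_lower_def)
qed

lemma continuous_on_V_lower: "continuous_on S (V_lower T c \<Lambda>)"
proof -
  have "V_lower T c \<Lambda> = (\<lambda>z. fst (snd z)
      + min (T - fst z) (min (snd (snd z)) (min (sqrt 2 / 2 * (fst z - snd (snd z))) (fst (snd z))))
      - N2 T c \<Lambda> * (T - fst z))"
    by (auto simp: V_lower_def dist_D_eq)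
  then show ?thesis
    by (auto intro!: continuous_intros)
qed

lemma continuous_on_imp_upper_semicontinuous_on:
  "continuous_on S f \<Longrightarrow> upper_semicontinuous_on S f"
  unfolding upper_semicontinuous_on_def continuous_on_def by (auto intro: order_tendstoD)

lemma terminal_boundary_dom_D_star_nonempty:
  assumes "T > 0"
  shows "terminal_boundary T (dom_D_star T) \<noteq> {}"
proof -
  have "(T, 0, 0) \<in> closure (dom_D_star T)"
    unfolding closure_approachable
  proof (intro allI impI)
    fix e :: real
    assume "e > 0"
    define s where "s = max 0 (T - e / 2)"
    have "(s, 0, 0) \<in> dom_D_star T" "dist (s, 0::real, 0::real) (T, 0, 0) < e"
      using \<open>T > 0\<close> \<open>e > 0\<close> by (auto simp: s_def dom_D_star_def dom_D_def dist_Pair_Pair dist_real_def)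
    then show "\<exists>y\<in>dom_D_star T. dist y (T, 0, 0) < e"
      by blast
  qed
  moreover have "(T, 0, 0) \<notin> interior (dom_D_star T)"
    using interior_subset by (auto simp: dom_D_star_def)
  ultimately show ?thesis
    by (auto simp: terminal_boundary_def frontier_def)
qed

section \<open>The jump term\<close>

text \<open>Claim sizes in \<open>{0..x}\<close> have total mass at most \<open>1\<close>, so integrating the constant \<open>- K \<le> 0\<close>
  gives at least \<open>- K\<close>. For a non-integrable \<open>f\<close> the integral is \<open>0\<close> by convention, and the bound
  holds because of \<open>K \<ge> 0\<close>.\<close>

lemma claim_integral_ge:
  fixes f :: "real \<Rightarrow> real"
  assumes G: "mono G" "continuous_on UNIV G" "\<And>u. u < 0 \<Longrightarrow> G u = 0" "(G \<longlongrightarrow> 1) at_top"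
    and "0 \<le> x" and "0 \<le> K" and ge: "\<And>u. u \<in> {0..x} \<Longrightarrow> - K \<le> f u"
  shows "- K \<le> (LINT u:{0..x}|interval_measure G. f u)"
proof (cases "set_integrable (interval_measure G) {0..x} f")
  case True
  let ?M = "interval_measure G"
  have mono: "\<And>a b. a \<le> b \<Longrightarrow> G a \<le> G b"
    using \<open>mono G\<close> by (rule monoD)
  have em: "emeasure ?M {0..x} = ennreal (G x - G 0)"
    using emeasure_interval_measure_Icc[OF \<open>0 \<le> x\<close> mono G(2)] .
  have "\<forall>\<^sub>F u in at_top. G x \<le> G u"
    using eventually_ge_at_top[of x] by eventually_elim (rule mono)
  then have "G x \<le> 1"
    by (intro tendsto_lowerbound[OF G(4)]) auto
  moreover have "0 \<le> G 0"
    using mono[of "-1" 0] G(3)[of "-1"] by simp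
  moreover have "measure ?M {0..x} = G x - G 0"
    using em mono[OF \<open>0 \<le> x\<close>] by (simp add: measure_def)
  ultimately have mass: "measure ?M {0..x} \<le> 1"
    by linarith
  have "- K \<le> measure ?M {0..x} * - K"
    using mult_right_mono[OF mass \<open>0 \<le> K\<close>] by simp
  also have "\<dots> = (LINT u:{0..x}|?M. - K)"
    by (simp add: set_lebesgue_integral_def)
  also have "\<dots> \<le> (LINT u:{0..x}|?M. f u)"
  proof (rule set_integral_mono[OF _ True ge])
    show "set_integrable ?M {0..x} (\<lambda>u. - K)"
      using em by (simp add: set_integrable_def)
  qed
  finally show ?thesis .
next
  case False
  then show ?thesis
    using \<open>0 \<le> K\<close>
    by (simp add: set_integrable_def set_lebesgue_integral_def not_integrable_integral_eq)
qed

section \<open>The subsolution property\<close>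

text \<open>If \<open>\<phi>\<^sub>x > 1\<close>, the \<open>x\<close>-slope forces \<open>d = x\<close> at the contact point. There the drift contributes at
  least \<open>N2 - 1\<close>, and \<open>N2\<close> is exactly large enough to absorb the discounting and the jump term at
  the largest possible \<open>x\<close>, the inradius, with \<open>sqrt 2 / 2\<close> to spare.\<close>

lemma test_function_inequality:
  fixes T p c \<Lambda> :: real and G lam :: "real \<Rightarrow> real"
  assumes "T > 0" "p > 0" "c > 0" "\<Lambda> > 0"
    and G: "mono G" "continuous_on UNIV G" "\<And>u. u < 0 \<Longrightarrow> G u = 0" "(G \<longlongrightarrow> 1) at_top"
    and lam: "\<And>w. w \<in> {0..T} \<Longrightarrow> 0 \<le> lam w" "\<And>w. w \<in> {0..T} \<Longrightarrow> lam w \<le> \<Lambda>"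
    and z: "(s, x, w) \<in> dom_D_star T"
    and "dom_D_star T \<subseteq> S" and diff: "\<phi> differentiable (at (s, x, w) within S)"
    and touch: "\<phi> (s, x, w) = V_lower T c \<Lambda> (s, x, w)"
    and above: "\<And>y. y \<in> dom_D_star T \<Longrightarrow> V_lower T c \<Lambda> y \<le> \<phi> y"
  shows "0 \<le> max (1 - deriv_x S \<phi> (s, x, w)) (gen_L p c G lam S \<phi> (s, x, w))"
proof (cases "deriv_x S \<phi> (s, x, w) \<le> 1")
  case True
  then show ?thesis
    by simp
next
  case False
  let ?V = "V_lower T c \<Lambda>" and ?d = "dist_D T" and ?N = "N2 T c \<Lambda>"
  define F where "F = frechet_derivative \<phi> (at (s, x, w) within S)"
  have F: "(\<phi> has_derivative F) (at (s, x, w) within S)"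
    using diff frechet_derivative_works unfolding F_def by blast
  interpret F: linear F
    using F by (rule has_derivative_linear)
  have Fx: "F (0, 1, 0) > 1"
    using False by (simp add: deriv_x_def F_def)
  have dom: "0 \<le> s" "s < T" "0 \<le> x" "0 \<le> w" "w \<le> s"
    using z by (auto simp: dom_D_star_def dom_D_def)
  have "?d (s, x, w) = x"
  proof (rule ccontr)
    assume "?d (s, x, w) \<noteq> x"
    then have less: "?d (s, x, w) < x"
      by (auto simp: dist_D_eq min_def split: if_splits)
    have "- 1 \<le> F (0, - 1, 0)"
    proof (rule has_derivative_within_ge_slope[OF F, where \<delta> = "x - ?d (s, x, w)"])
      fix t :: real
      assume t: "0 < t" "t < x - ?d (s, x, w)"
      have "0 \<le> ?d (s, x, w)"
        using z by (auto simp: dom_D_star_def intro: dist_D_nonneg)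
      with t dom have *: "(s, x - t, w) \<in> dom_D_star T"
        by (auto simp: dom_D_star_def dom_D_def)
      then show "(s, x, w) + t *\<^sub>R (0, - 1, 0) \<in> S"
        using \<open>dom_D_star T \<subseteq> S\<close> by auto
      \<comment> \<open>Up to the chosen step size the slack in \<open>x\<close> keeps the minimum unchanged.\<close>
      have "?d (s, x - t, w) = ?d (s, x, w)"
        using t by (auto simp: dist_D_eq min_def split: if_splits)
      then have "?V (s, x - t, w) = ?V (s, x, w) - t"
        by (simp add: V_lower_def)
      then show "\<phi> (s, x, w) + - 1 * t \<le> \<phi> ((s, x, w) + t *\<^sub>R (0, - 1, 0))"
        using above[OF *] touch by simp
    qed (use less in simp)
    moreover have "F (0, - 1, 0) = - F (0, 1, 0)"
      using F.neg[of "(0, 1, 0)"] by simp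
    ultimately show False
      using Fx by simp
  qed
  then have x_le: "x \<le> T / (2 + sqrt 2)" and \<phi>_eq: "\<phi> (s, x, w) = 2 * x - ?N * (T - s)"
    using dist_D_le_inradius[of T s x w] touch by (auto simp: V_lower_def)
  have drift: "?N - 1 \<le> F (1, 0, 1)"
  proof (rule has_derivative_within_ge_slope[OF F, where \<delta> = "T - s"])
    fix t :: real
    assume t: "0 < t" "t < T - s"
    with dom have *: "(s + t, x, w + t) \<in> dom_D_star T"
      by (auto simp: dom_D_star_def dom_D_def)
    then show "(s, x, w) + t *\<^sub>R (1, 0, 1) \<in> S"
      using \<open>dom_D_star T \<subseteq> S\<close> by auto
    have "?d (s, x, w) - t \<le> ?d (s + t, x, w + t)"
      using t by (auto simp: dist_D_eq min_def)
    then have "?V (s, x, w) + (?N - 1) * t \<le> ?V (s + t, x, w + t)"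
      by (simp add: V_lower_def algebra_simps)
    then show "\<phi> (s, x, w) + (?N - 1) * t \<le> \<phi> ((s, x, w) + t *\<^sub>R (1, 0, 1))"
      using above[OF *] touch by simp
  qed (use dom in simp)
  have "F (1, 0, 1) = F (1, 0, 0) + F (0, 0, 1)"
    using F.add[of "(1, 0, 0)" "(0, 0, 1)"] by simp
  then have derivs: "?N - 1 \<le> deriv_s S \<phi> (s, x, w) + p * deriv_x S \<phi> (s, x, w) + deriv_w S \<phi> (s, x, w)"
    using drift Fx mult_pos_pos[OF \<open>p > 0\<close>, of "F (0, 1, 0)"]
    by (simp add: deriv_s_def deriv_x_def deriv_w_def F_def)
  have N_nonneg: "0 \<le> ?N * (T - s)"
    using N2_pos[OF assms(1,3,4)] dom by simp
  let ?I = "LINT u:{0..x}|interval_measure G. \<phi> (s, x - u, 0)"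
  have "- (?N * (T - s)) \<le> ?I"
  proof (rule claim_integral_ge[OF G \<open>0 \<le> x\<close> N_nonneg])
    fix u
    assume u: "u \<in> {0..x}"
    with dom have "(s, x - u, 0) \<in> dom_D_star T"
      by (auto simp: dom_D_star_def dom_D_def)
    from above[OF this] show "- (?N * (T - s)) \<le> \<phi> (s, x - u, 0)"
      using u dom dist_D_nonneg[of s "x - u" 0 T] by (simp add: V_lower_def dom_D_def)
  qed
  then have "- (2 * x) \<le> ?I - \<phi> (s, x, w)"
    using \<phi>_eq by simp
  then have "lam w * - (2 * x) \<le> lam w * (?I - \<phi> (s, x, w))"
    using lam(1)[of w] dom by (intro mult_left_mono) auto
  moreover have "lam w * (2 * x) \<le> \<Lambda> * (2 * x)"
    using lam(2)[of w] dom by (intro mult_right_mono) auto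
  moreover have "- c * \<phi> (s, x, w) \<ge> - (c * (2 * x))"
    using mult_nonneg_nonneg[OF _ N_nonneg, of c] \<open>c > 0\<close> by (simp add: \<phi>_eq algebra_simps)
  moreover have "(c + \<Lambda>) * (2 * x) \<le> (c + \<Lambda>) * (2 * T / (2 + sqrt 2))"
    using x_le \<open>c > 0\<close> \<open>\<Lambda> > 0\<close> by (intro mult_left_mono) auto
  then have "c * (2 * x) + \<Lambda> * (2 * x) \<le> ?N - 1 - sqrt 2 / 2"
    by (simp add: N2_def distrib_right)
  moreover have "0 \<le> sqrt 2 / 2"
    by simp
  ultimately have "0 \<le> gen_L p c G lam S \<phi> (s, x, w)"
    using derivs unfolding gen_L_def prod.case by linarith
  then show ?thesis
    by simp
qed

theorem theorem6p3:
  fixes T p c \<Lambda> :: real and G lam :: "real \<Rightarrow> real"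
  assumes "T > 0" and "p > 0" and "c > 0"
    and "mono G" and "continuous_on UNIV G"
    and "\<And>u. u < 0 \<Longrightarrow> G u = 0" and "(G \<longlongrightarrow> 1) at_top"
    and "continuous_on {0..} lam" and "bounded (lam ` {0..})"
    and "\<And>w. w \<ge> 0 \<Longrightarrow> lam w \<ge> 0"
    and "\<And>w. w \<in> {0..T} \<Longrightarrow> lam w > 0"
    and "\<Lambda> > 0" and "\<And>w. w \<in> {0..T} \<Longrightarrow> lam w \<le> \<Lambda>"
  shows "viscosity_subsolution T p c G lam (dom_D_star T) (V_lower T c \<Lambda>) \<and>
    (\<forall>s x w. (s, x, w) \<in> dom_D T \<longrightarrow>
       x + M2 T c \<Lambda> \<le> V_lower T c \<Lambda> (s, x, w) \<and> V_lower T c \<Lambda> (s, x, w) \<le> x + M1 T p)"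
proof (intro conjI allI impI)
  show "viscosity_subsolution T p c G lam (dom_D_star T) (V_lower T c \<Lambda>)"
    unfolding viscosity_subsolution_def
  proof (intro conjI ballI allI impI)
    show "terminal_boundary T (dom_D_star T) \<noteq> {}"
      using \<open>T > 0\<close> by (rule terminal_boundary_dom_D_star_nonempty)
    show "upper_semicontinuous_on (dom_D_star T) (V_lower T c \<Lambda>)"
      by (intro continuous_on_imp_upper_semicontinuous_on continuous_on_V_lower)
    show "V_lower T c \<Lambda> (T, y, r) \<le> y" for y r
      by (simp add: V_lower_def dist_D_eq)
    fix z \<phi>
    assume z: "z \<in> dom_D_star T"
      and \<phi>: "C1_on (closure (dom_D_star T)) \<phi> \<and> V_lower T c \<Lambda> z - \<phi> z = 0 \<and>
        (\<forall>y\<in>dom_D_star T. V_lower T c \<Lambda> y - \<phi> y \<le> V_lower T c \<Lambda> z - \<phi> z)"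
    obtain s x w where z_eq: "z = (s, x, w)"
      by (cases z) auto
    show "0 \<le> max (1 - deriv_x (closure (dom_D_star T)) \<phi> z)
      (gen_L p c G lam (closure (dom_D_star T)) \<phi> z)"
      unfolding z_eq
    proof (rule test_function_inequality[where \<Lambda> = \<Lambda>])
      show "\<phi> differentiable at (s, x, w) within closure (dom_D_star T)"
        using \<phi> z closure_subset unfolding C1_on_def differentiable_on_def z_eq by blast
      show "V_lower T c \<Lambda> y \<le> \<phi> y" if "y \<in> dom_D_star T" for y
        using \<phi> that by fastforce
      show "dom_D_star T \<subseteq> closure (dom_D_star T)"
        by (rule closure_subset)
    qed (use assms z \<phi> in \<open>auto simp: z_eq\<close>)
  qed (auto simp: dom_D_star_def)
next
  fix s x w
  assume D: "(s, x, w) \<in> dom_D T"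
  note bounds = V_lower_bounds[OF \<open>T > 0\<close> \<open>p > 0\<close> \<open>c > 0\<close> \<open>\<Lambda> > 0\<close> D]
  show "x + M2 T c \<Lambda> \<le> V_lower T c \<Lambda> (s, x, w)"
    by (rule bounds(1))
  show "V_lower T c \<Lambda> (s, x, w) \<le> x + M1 T p"
    by (rule bounds(2))
qed

end
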